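(* Let $G$ be a connected graph on $n\geq 13$ vertices with minimum degree $\delta\geq 3$. If $$q(G)> 2n-6+\frac{6}{n-1},$$ then $G$ is Hamilton-connected unless $G=S_{n}^{3}$.
   Context: All graphs are finite and simple (no loops or multiple edges); equality of graphs is up to isomorphism. $\delta=\delta(G)$ is the minimum degree of $G$. $q(G)$ is the signless Laplacian spectral radius of $G$, i.e. the largest eigenvalue of $Q(G)=D(G)+A(G)$, where $A(G)$ is the adjacency matrix and $D(G)$ the diagonal matrix of vertex degrees of $G$. A Hamilton path is a path containing all vertices of $G$; $G$ is Hamilton-connected if every two (distinct) vertices of $G$ are connected by a Hamilton path. $G+H$ and $G\vee H$ denote the disjoint union and the join of $G$ and $H$; $kG$ is the disjoint union of $k$ copies of $G$; $K_n$ is the complete graph on $n$ vertices. The graph $S_n^3$ is $$S_{n}^{3}=K_{3}\vee (K_{n-5}+2K_{1}).$$ *)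

theory Defs
  imports
    "Graph_Theory.Graph_Theory"
    "Jordan_Normal_Form.Spectral_Radius"
begin

text \<open>
  A finite simple graph is a symmetric loop-free digraph whose arcs are pairs of vertices
  (locale \<^locale>\<open>pair_graph\<close>): an edge \<open>uv\<close> is the pair of arcs \<open>(u, v)\<close> and \<open>(v, u)\<close>.
  Hence the degree of a vertex is its out-degree (equally, its in-degree).
\<close>

definition min_degree :: "'a pair_pre_digraph \<Rightarrow> nat" where
  "min_degree G = Min (out_degree G ` pverts G)"


subsection \<open>Signless Laplacian\<close>

text \<open>
  Matrices are indexed by \<open>0, \<dots>, n - 1\<close>, so the vertices have to be numbered. The numbering
  is arbitrary: another one conjugates the matrices below by a permutation matrix and so
  leaves the spectrum unchanged.
\<close>

definition vertex_list :: "'a pair_pre_digraph \<Rightarrow> 'a list" where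
  "vertex_list G = (SOME vs. distinct vs \<and> set vs = pverts G)"

definition adjacency_mat :: "'a pair_pre_digraph \<Rightarrow> real mat" where
  "adjacency_mat G = mat (card (pverts G)) (card (pverts G))
     (\<lambda>(i, j). if (vertex_list G ! i, vertex_list G ! j) \<in> parcs G then 1 else 0)"

definition degree_mat :: "'a pair_pre_digraph \<Rightarrow> real mat" where
  "degree_mat G = mat (card (pverts G)) (card (pverts G))
     (\<lambda>(i, j). if i = j then real (out_degree G (vertex_list G ! i)) else 0)"

definition signless_laplacian :: "'a pair_pre_digraph \<Rightarrow> real mat" where
  "signless_laplacian G = degree_mat G + adjacency_mat G"

text \<open>
  The spectrum is taken over the reals; the matrix being symmetric, it contains all eigenvalues.
\<close>

definition signless_laplacian_radius :: "'a pair_pre_digraph \<Rightarrow> real" where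
  "signless_laplacian_radius G = Max (spectrum (signless_laplacian G))"


subsection \<open>Hamilton-connected graphs\<close>

definition hamilton_path :: "'a list \<Rightarrow> 'a pair_pre_digraph \<Rightarrow> bool" where
  "hamilton_path p G \<longleftrightarrow> vpath p G \<and> set p = pverts G"

definition hamilton_connected :: "'a pair_pre_digraph \<Rightarrow> bool" where
  "hamilton_connected G \<longleftrightarrow>
     (\<forall>u\<in>pverts G. \<forall>v\<in>pverts G. u \<noteq> v \<longrightarrow> (\<exists>p. hamilton_path p G \<and> hd p = u \<and> last p = v))"


subsection \<open>Graph operations\<close>

definition complete_graph :: "nat \<Rightarrow> nat pair_pre_digraph" where
  "complete_graph n = \<lparr> pverts = {..<n}, parcs = {(i, j). i < n \<and> j < n \<and> i \<noteq> j} \<rparr>"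

definition disjoint_union ::
    "'a pair_pre_digraph \<Rightarrow> 'b pair_pre_digraph \<Rightarrow> ('a + 'b) pair_pre_digraph" where
  "disjoint_union G H = \<lparr> pverts = pverts G <+> pverts H,
     parcs = {(Inl u, Inl v) | u v. (u, v) \<in> parcs G} \<union> {(Inr u, Inr v) | u v. (u, v) \<in> parcs H} \<rparr>"

definition graph_join ::
    "'a pair_pre_digraph \<Rightarrow> 'b pair_pre_digraph \<Rightarrow> ('a + 'b) pair_pre_digraph" where
  "graph_join G H = \<lparr> pverts = pverts G <+> pverts H,
     parcs = parcs (disjoint_union G H)
       \<union> {(Inl u, Inr v) | u v. u \<in> pverts G \<and> v \<in> pverts H}
       \<union> {(Inr v, Inl u) | u v. u \<in> pverts G \<and> v \<in> pverts H} \<rparr>"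

definition graph_copies :: "nat \<Rightarrow> 'a pair_pre_digraph \<Rightarrow> (nat \<times> 'a) pair_pre_digraph" where
  "graph_copies k G = \<lparr> pverts = {..<k} \<times> pverts G,
     parcs = {((i, u), (i, v)) | i u v. i < k \<and> (u, v) \<in> parcs G} \<rparr>"

text \<open>The graph \<open>S\<^sub>n\<^sup>3\<close>, meaningful for \<open>n \<ge> 5\<close>.\<close>

definition S3_graph :: "nat \<Rightarrow> (nat + (nat + nat \<times> nat)) pair_pre_digraph" where
  "S3_graph n =
     graph_join (complete_graph 3)
       (disjoint_union (complete_graph (n - 5)) (graph_copies 2 (complete_graph 1)))"

end

theory Submission
  imports Defs
begin

text \<open>
  Write \<open>Q\<close> for the signless Laplacian and \<open>q\<close> for its largest eigenvalue. Every spectral step rests on one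
  principle: if a positive vector \<open>x\<close> satisfies \<open>Q x \<le> c x\<close> entrywise, then \<open>q \<le> c\<close>
  (\<open>radius_le_of_positive_test_vector\<close>).
  
  With \<open>m\<close> edges, the vector of degrees gives \<open>q \<le> 2m / (n - 1) + n - 2\<close> (\<open>radius_le_size\<close>), so the
  hypothesis on \<open>q\<close> forces \<open>2m > (n - 1)(n - 4) + 6\<close>. If \<open>G\<close> is not Hamilton-connected, then for some
  \<open>k \<le> n / 2\<close> at least \<open>k - 1\<close> vertices have degree at most \<open>k\<close> and at least \<open>n - k\<close> have degree at most
  \<open>n - k\<close> (\<open>degree_sequence_not_hamilton_connected\<close>, by the closure argument of Bondy and Chvatal). This
  bounds \<open>2m\<close> from above, and for \<open>k \<ge> 3\<close>, \<open>n \<ge> 13\<close> the two bounds are compatible only for \<open>k = 3\<close> and for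
  \<open>(k, n) = (6, 13), (7, 14)\<close> (\<open>large_size_cases\<close>). In the two sporadic cases so many vertices have
  small degree that a test vector with two values contradicts the hypothesis
  (\<open>many_low_degrees_radius_le\<close>).
  
  For \<open>k = 3\<close> there are two vertices \<open>a\<close>, \<open>b\<close> of degree 3. On a complete graph formed by the other \<open>n - 2\<close>
  vertices the radius is \<open>2n - 6\<close>. To first order, each edge from \<open>{a, b}\<close> to these vertices adds \<open>1 / n\<close>
  to it and each edge missing among them subtracts \<open>4 / n\<close>; the threshold leaves room for \<open>6 / (n - 1)\<close>.
  If \<open>a\<close> and \<open>b\<close> are adjacent, only four edges are added; if an edge is missing, the balance is at
  most \<open>6 - 4\<close>. Explicit test vectors show that in both cases \<open>q\<close> stays below the threshold
  (\<open>adjacent_radius_le\<close>, \<open>missing_edge_radius_le\<close>). So \<open>a\<close> and \<open>b\<close> are not adjacent and the other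
  vertices form a complete graph. Then each neighbour of \<open>a\<close> or \<open>b\<close> has degree at least \<open>n - 2\<close>, but at most
  three vertices do; hence \<open>a\<close> and \<open>b\<close> have the same three neighbours, which describes \<open>S\<^sub>n\<^sup>3\<close>.
\<close>


section \<open>Eigenvalue bounds from positive test vectors\<close>

text \<open>
  Compare the eigenvector \<open>v\<close> with \<open>x\<close> in the row where \<open>\<bar>v $ i\<bar> / x i\<close> is largest: there \<open>\<bar>v\<bar>\<close> is dominated by a
  multiple of \<open>x\<close> that is attained at \<open>i\<close>, so the row of \<open>x\<close> bounds the eigenvalue.
\<close>

lemma eigenvalue_le_of_positive_test_vector:
  fixes A :: "real mat"
  assumes A: "A \<in> carrier_mat n n" and nonneg: "\<And>i j. i < n \<Longrightarrow> j < n \<Longrightarrow> A $$ (i, j) \<ge> 0"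
    and pos: "\<And>i. i < n \<Longrightarrow> x i > 0"
    and le: "\<And>i. i < n \<Longrightarrow> (\<Sum>j<n. A $$ (i, j) * x j) \<le> c * x i"
    and ev: "eigenvalue A \<mu>"
  shows "\<mu> \<le> c"
proof -
  obtain v where v: "v \<in> carrier_vec n" "v \<noteq> 0\<^sub>v n" "A *\<^sub>v v = \<mu> \<cdot>\<^sub>v v"
    using ev A unfolding eigenvalue_def eigenvector_def by auto
  have row: "(\<Sum>j<n. A $$ (i, j) * v $ j) = \<mu> * v $ i" if "i < n" for i
  proof -
    have "(A *\<^sub>v v) $ i = (\<Sum>j<n. A $$ (i, j) * v $ j)"
      using A v(1) that by (auto simp: scalar_prod_def lessThan_atLeast0 intro!: sum.cong)
    then show ?thesis using v that by simp
  qed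
  obtain i0 where i0: "i0 < n" "v $ i0 \<noteq> 0"
    using v(1,2) by (metis carrier_vecD eq_vecI index_zero_vec(1,2))
  define r where "r i = \<bar>v $ i\<bar> / x i" for i
  obtain i where i: "i < n" "\<And>j. j < n \<Longrightarrow> r j \<le> r i"
  proof -
    have "finite (r ` {..<n})" "r ` {..<n} \<noteq> {}" using i0 by auto
    then have "Max (r ` {..<n}) \<in> r ` {..<n}" by (rule Max_in)
    then obtain i where "i < n" and max: "r i = Max (r ` {..<n})" by auto
    moreover have "r j \<le> r i" if "j < n" for j
      using that max by auto
    ultimately show thesis using that by blast
  qed
  have abs_le: "\<bar>v $ j\<bar> \<le> r i * x j" if "j < n" for j
    using i(2)[OF that] pos[OF that] by (simp add: r_def field_simps)
  have ri: "r i > 0"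
    using i(2)[OF i0(1)] i0 pos[OF i0(1)] by (auto simp: r_def intro: less_le_trans[rotated])
  have vi: "\<bar>v $ i\<bar> = r i * x i" using pos[OF i(1)] by (simp add: r_def)
  have "\<mu> * (r i * x i) \<le> \<bar>\<mu> * v $ i\<bar>"
    unfolding vi[symmetric] abs_mult by (intro mult_right_mono) auto
  also have "\<dots> = \<bar>\<Sum>j<n. A $$ (i, j) * v $ j\<bar>" using row[OF i(1)] by simp
  also have "\<dots> \<le> (\<Sum>j<n. \<bar>A $$ (i, j) * v $ j\<bar>)" by (rule sum_abs)
  also have "\<dots> \<le> (\<Sum>j<n. r i * (A $$ (i, j) * x j))"
  proof (rule sum_mono)
    fix j assume "j \<in> {..<n}"
    then have "A $$ (i, j) * \<bar>v $ j\<bar> \<le> A $$ (i, j) * (r i * x j)"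
      using nonneg[OF i(1)] abs_le by (intro mult_left_mono) auto
    then show "\<bar>A $$ (i, j) * v $ j\<bar> \<le> r i * (A $$ (i, j) * x j)"
      using nonneg[OF i(1), of j] \<open>j \<in> _\<close> by (simp add: abs_mult algebra_simps)
  qed
  also have "\<dots> = r i * (\<Sum>j<n. A $$ (i, j) * x j)" by (simp add: sum_distrib_left)
  also have "\<dots> \<le> r i * (c * x i)" using le[OF i(1)] ri by (intro mult_left_mono) auto
  finally have "\<mu> * (r i * x i) \<le> c * (r i * x i)" by (simp add: algebra_simps)
  then show ?thesis using ri pos[OF i(1)] by simp
qed

text \<open>
  A maximum over an empty spectrum would be meaningless, so a real eigenvalue has to be exhibited. Over
  the complex numbers one exists; let \<open>a + \<i>b\<close> be an eigenvector for \<open>z\<close>. Computing the symmetric form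
  \<open>b \<bullet> A a = a \<bullet> A b\<close> in two ways gives \<open>Im z (\<bar>a\<bar>\<^sup>2 + \<bar>b\<bar>\<^sup>2) = 0\<close>. Hence \<open>z\<close> is real, and \<open>a\<close> or \<open>b\<close>, whichever
  is nonzero, is a real eigenvector.
\<close>

lemma symmetric_real_mat_spectrum_nonempty:
  fixes A :: "real mat"
  assumes A: "A \<in> carrier_mat n n" and n: "n > 0"
    and sym: "\<And>i j. i < n \<Longrightarrow> j < n \<Longrightarrow> A $$ (i, j) = A $$ (j, i)"
  shows "spectrum A \<noteq> {}"
proof -
  let ?C = "map_mat complex_of_real A"
  have C: "?C \<in> carrier_mat n n" using A by simp
  obtain z where "eigenvalue ?C z"
    using spectrum_non_empty[OF C] n unfolding spectrum_def by blast
  then obtain w where w: "w \<in> carrier_vec n" "w \<noteq> 0\<^sub>v n" "?C *\<^sub>v w = z \<cdot>\<^sub>v w"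
    using A unfolding eigenvalue_def eigenvector_def by auto
  define a where "a i = Re (w $ i)" for i
  define b where "b i = Im (w $ i)" for i
  have row: "(\<Sum>j<n. of_real (A $$ (i, j)) * w $ j) = z * w $ i" if "i < n" for i
  proof -
    have "(?C *\<^sub>v w) $ i = (\<Sum>j<n. of_real (A $$ (i, j)) * w $ j)"
      using A w(1) that by (auto simp: scalar_prod_def lessThan_atLeast0 intro!: sum.cong)
    then show ?thesis using w that by simp
  qed
  have ra: "(\<Sum>j<n. A $$ (i, j) * a j) = Re z * a i - Im z * b i" if "i < n" for i
    using arg_cong[OF row[OF that], of Re] by (simp add: a_def b_def)
  have rb: "(\<Sum>j<n. A $$ (i, j) * b j) = Re z * b i + Im z * a i" if "i < n" for i
    using arg_cong[OF row[OF that], of Im] by (simp add: a_def b_def)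
  have "(\<Sum>i<n. b i * (\<Sum>j<n. A $$ (i, j) * a j)) = (\<Sum>i<n. \<Sum>j<n. b i * A $$ (i, j) * a j)"
    by (simp add: sum_distrib_left algebra_simps)
  also have "\<dots> = (\<Sum>j<n. \<Sum>i<n. b i * A $$ (i, j) * a j)" by (rule sum.swap)
  also have "\<dots> = (\<Sum>j<n. a j * (\<Sum>i<n. A $$ (j, i) * b i))"
    unfolding sum_distrib_left by (intro sum.cong refl) (simp add: sym)
  finally have "(\<Sum>i<n. b i * (Re z * a i - Im z * b i)) = (\<Sum>j<n. a j * (Re z * b j + Im z * a j))"
    using ra rb by simp
  then have "(\<Sum>i<n. b i * (Re z * a i - Im z * b i) - a i * (Re z * b i + Im z * a i)) = 0"
    by (simp add: sum_subtractf)
  then have "Im z * (\<Sum>i<n. a i * a i + b i * b i) = 0"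
    by (simp add: sum_distrib_left algebra_simps sum.distrib sum_subtractf sum_negf)
  moreover obtain i0 where i0: "i0 < n" "w $ i0 \<noteq> 0"
    using w(1,2) by (metis carrier_vecD eq_vecI index_zero_vec(1,2))
  have ab: "a i0 \<noteq> 0 \<or> b i0 \<noteq> 0" using i0(2) by (auto simp: a_def b_def complex_eq_iff)
  have "(\<Sum>i<n. a i * a i + b i * b i) > 0"
    using i0(1) ab by (intro sum_pos2[of _ i0]) (auto simp: sum_squares_gt_zero_iff)
  ultimately have z: "Im z = 0" by simp
  have real_ev: "eigenvalue A (Re z)" if f: "f i0 \<noteq> 0"
    and r: "\<And>i. i < n \<Longrightarrow> (\<Sum>j<n. A $$ (i, j) * f j) = Re z * f i" for f
  proof -
    have "A *\<^sub>v vec n f = Re z \<cdot>\<^sub>v vec n f"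
    proof (rule eq_vecI)
      fix i assume "i < dim_vec (Re z \<cdot>\<^sub>v vec n f)"
      then have i: "i < n" by simp
      have "(A *\<^sub>v vec n f) $ i = (\<Sum>j<n. A $$ (i, j) * f j)"
        using A i by (auto simp: scalar_prod_def lessThan_atLeast0 intro!: sum.cong)
      then show "(A *\<^sub>v vec n f) $ i = (Re z \<cdot>\<^sub>v vec n f) $ i" using r i by simp
    qed (use A in auto)
    moreover have "vec n f \<noteq> 0\<^sub>v n" using f i0(1) by (metis index_vec index_zero_vec(1))
    ultimately show ?thesis using A unfolding eigenvalue_def eigenvector_def
      by (metis carrier_matD(1) vec_carrier)
  qed
  have "eigenvalue A (Re z)"
    using ab real_ev[of a] real_ev[of b] ra rb z by auto
  then show ?thesis unfolding spectrum_def by auto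
qed


section \<open>Neighbourhoods and Hamilton paths\<close>

definition neighbours :: "'a pair_pre_digraph \<Rightarrow> 'a \<Rightarrow> 'a set" where
  "neighbours G v = {w. (v, w) \<in> parcs G}"

lemma out_degree_neighbours:
  fixes G :: "'a pair_pre_digraph"
  shows "out_degree G v = card (neighbours G v)"
proof -
  have "out_arcs (with_proj G) v = Pair v ` neighbours G v"
    by (auto simp: out_arcs_def neighbours_def)
  then show ?thesis by (simp add: out_degree_def card_image inj_on_def)
qed

abbreviation adj :: "'a pair_pre_digraph \<Rightarrow> 'a \<Rightarrow> 'a \<Rightarrow> bool" where
  "adj G u v \<equiv> (u, v) \<in> parcs G"

lemma hamilton_path_iff:
  "hamilton_path p G \<longleftrightarrow> p \<noteq> [] \<and> distinct p \<and> set p = pverts G \<and> successively (adj G) p"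
proof -
  have "set (vwalk_arcs p) \<subseteq> parcs G \<longleftrightarrow> successively (adj G) p"
    by (induction p rule: vwalk_arcs.induct) auto
  then show ?thesis by (auto simp: hamilton_path_def vpath_def vwalk_def)
qed

lemma pair_graphI:
  assumes "finite (pverts G)" "parcs G \<subseteq> pverts G \<times> pverts G" "sym (parcs G)" "irrefl (parcs G)"
  shows "pair_graph G"
proof -
  have "finite (parcs G)" using assms(1,2) finite_subset by blast
  then show ?thesis
    using assms by unfold_locales (auto simp: symmetric_def irrefl_def)
qed

lemma pair_graphD:
  assumes "pair_graph G"
  shows "finite (pverts G)" "parcs G \<subseteq> pverts G \<times> pverts G" "sym (parcs G)" "irrefl (parcs G)"
proof -
  interpret pair_graph G by fact
  show "finite (pverts G)" "parcs G \<subseteq> pverts G \<times> pverts G" by (auto dest: wellformed')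
  show "sym (parcs G)" "irrefl (parcs G)"
    using sym_arcs by (auto simp: symmetric_def irrefl_def dest: no_loops')
qed

context pair_graph begin

lemma adj_sym: "adj G u v \<longleftrightarrow> adj G v u"
  using arcs_symmetric by blast

lemma finite_neighbours: "finite (neighbours G v)"
  by (rule finite_subset[of _ "pverts G"]) (auto simp: neighbours_def dest: in_arcsD2)

lemma neighbours_subset: "neighbours G v \<subseteq> pverts G - {v}"
  by (auto simp: neighbours_def dest: in_arcsD2 no_loops')

lemma degree_le: "out_degree G v \<le> card (pverts G) - 1" if "v \<in> pverts G"
proof -
  have "card (neighbours G v) \<le> card (pverts G - {v})"
    using neighbours_subset by (intro card_mono) auto
  then show ?thesis using that by (simp add: out_degree_neighbours)
qed

end


section \<open>Degree sequences of graphs that are not Hamilton-connected\<close>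

text \<open>
  The list \<open>xs @ s # t # ys\<close> is a Hamilton path of the graph with the edge \<open>st\<close> added. If \<open>s\<close> is adjacent to
  the \<open>j\<close>-th and \<open>t\<close> to the \<open>(j+1)\<close>-st vertex of it, reversing the segment between the broken and the
  new edge gives a Hamilton path of \<open>G\<close> with the same ends. So these sets of indices \<open>j\<close> are disjoint, and
  they miss the index of \<open>s\<close>; each determines the neighbourhood up to one end of the path.
\<close>

lemma rotation_degree_sum:
  assumes G: "pair_graph G"
    and p: "distinct (xs @ s # t # ys)" "set (xs @ s # t # ys) = pverts G"
    and walks: "successively (adj G) (xs @ [s])" "successively (adj G) (t # ys)"
    and st: "\<not> adj G s t"
    and no_path: "\<not> (\<exists>q. hamilton_path q G \<and> hd q = hd (xs @ [s]) \<and> last q = last (t # ys))"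
  shows "out_degree G s + out_degree G t \<le> card (pverts G)"
proof -
  interpret pair_graph G by fact
  define p where "p = xs @ s # t # ys"
  define i where "i = length xs"
  define n where "n = length p"
  have n: "n = card (pverts G)"
    using p distinct_card unfolding n_def p_def by metis
  have n_i: "i + 1 < n" by (simp add: n_def p_def i_def)
  define S where "S = {j. j < n - 1 \<and> adj G s (p ! j)}"
  define T where "T = {j. j < n - 1 \<and> adj G t (p ! Suc j)}"
  have adj_comm: "adj G x y = adj G y x" for x y by (rule adj_sym)
  have succ_rev: "successively (adj G) (rev zs) = successively (adj G) zs" for zs
  proof -
    have "(\<lambda>x y. adj G y x) = adj G" by (intro ext) (rule adj_comm)
    then show ?thesis by (simp only: successively_rev)
  qed
  have no_loop: "\<not> adj G x x" for x using no_loops' by blast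
  have disj: "S \<inter> T = {}"
  proof (rule ccontr)
    assume "S \<inter> T \<noteq> {}"
    then obtain j where j: "j < n - 1" "adj G s (p ! j)" "adj G t (p ! Suc j)"
      by (auto simp: S_def T_def)
    then have j': "adj G (p ! j) s" "adj G (p ! Suc j) t" using adj_comm by blast+
    have "j \<noteq> i" using j(2) no_loop by (auto simp: p_def i_def)
    then consider "j < i" | "j > i" by linarith
    then show False
    proof cases
      case 1
      define A where "A = take (Suc j) (xs @ [s])"
      define B where "B = drop (Suc j) (xs @ [s])"
      have AB: "xs @ [s] = A @ B" unfolding A_def B_def by (rule append_take_drop_id[symmetric])
      have ne: "A \<noteq> []" "B \<noteq> []" using 1 by (auto simp: A_def B_def i_def)
      have "last A = p ! j"
        using 1 by (simp add: A_def p_def i_def take_Suc_conv_app_nth nth_append)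
      moreover have "hd B = p ! Suc j"
        using 1 unfolding B_def p_def i_def by (subst hd_drop_conv_nth) (auto simp: nth_append)
      moreover have "last B = s" using AB ne by (metis last_appendR last_snoc)
      moreover have "successively (adj G) A \<and> successively (adj G) B"
        using walks(1) unfolding AB by (simp add: successively_append_iff)
      ultimately have "successively (adj G) (A @ rev B @ t # ys)"
        using walks(2) ne j j'
        by (auto simp: successively_append_iff succ_rev hd_rev last_rev simp del: successively_rev)
      moreover have eq: "xs @ s # t # ys = A @ B @ t # ys" using AB by simp
      ultimately have "hamilton_path (A @ rev B @ t # ys) G"
        using p unfolding hamilton_path_iff eq by auto
      moreover have "hd (A @ rev B @ t # ys) = hd (xs @ [s])" using AB ne by simp
      moreover have "last (A @ rev B @ t # ys) = last (t # ys)" by simp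
      ultimately show False using no_path by blast
    next
      case 2
      define A where "A = take (j - i) (t # ys)"
      define B where "B = drop (j - i) (t # ys)"
      have AB: "t # ys = A @ B" unfolding A_def B_def by (rule append_take_drop_id[symmetric])
      have len: "j - i < length (t # ys)" "0 < j - i"
        using 2 j(1) by (auto simp: n_def p_def i_def)
      have ne: "A \<noteq> []" "B \<noteq> []" using len by (auto simp: A_def B_def)
      obtain m where m: "j = Suc (i + m)" using 2 less_iff_Suc_add by auto
      have "last A = p ! j"
        using len unfolding A_def m p_def i_def
        by (simp add: nth_append take_Suc_conv_app_nth del: take_Suc_Cons)
      moreover have "hd B = p ! Suc j"
        using len unfolding B_def m p_def i_def by (subst hd_drop_conv_nth) (auto simp: nth_append)
      moreover have "hd A = t" using AB ne by (metis hd_append2 list.sel(1))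
      moreover have "successively (adj G) A \<and> successively (adj G) B"
        using walks(2) unfolding AB by (simp add: successively_append_iff)
      ultimately have "successively (adj G) ((xs @ [s]) @ rev A @ B)"
        using walks(1) ne j j'
        by (subst successively_append_iff)
          (auto simp: successively_append_iff succ_rev hd_rev last_rev simp del: successively_rev)
      moreover have eq: "xs @ s # t # ys = (xs @ [s]) @ A @ B" using AB by simp
      ultimately have "hamilton_path ((xs @ [s]) @ rev A @ B) G"
        using p unfolding hamilton_path_iff eq by auto
      moreover have "hd ((xs @ [s]) @ rev A @ B) = hd (xs @ [s])" by (cases xs) auto
      moreover have "last ((xs @ [s]) @ rev A @ B) = last (t # ys)" using AB ne by simp
      ultimately show False using no_path by blast
    qed
  qed
  have "i \<notin> S \<union> T"
    using no_loop by (auto simp: S_def T_def p_def i_def nth_append)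
  then have "S \<union> T \<subseteq> {..<n - 1} - {i}" by (auto simp: S_def T_def)
  then have "card (S \<union> T) \<le> card ({..<n - 1} - {i})" by (intro card_mono) auto
  then have ST: "card S + card T \<le> n - 2"
    using disj n_i by (simp add: card_Un_disjoint S_def T_def)
  have set_p: "set p = pverts G" using p by (simp add: p_def)
  have "neighbours G s \<subseteq> insert (p ! (n - 1)) ((!) p ` S)"
  proof
    fix w assume w: "w \<in> neighbours G s"
    then have "w \<in> set p" using neighbours_subset set_p by blast
    then obtain j where j: "j < n" "w = p ! j" by (auto simp: n_def in_set_conv_nth)
    show "w \<in> insert (p ! (n - 1)) ((!) p ` S)"
    proof (cases "j = n - 1")
      case False
      then have "j \<in> S" using j w by (auto simp: S_def neighbours_def)
      then show ?thesis using j by auto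
    qed (use j in auto)
  qed
  then have "card (neighbours G s) \<le> card (insert (p ! (n - 1)) ((!) p ` S))"
    by (intro card_mono) (auto simp: S_def)
  also have "\<dots> \<le> card S + 1"
    by (rule order.trans[OF card_insert_le_m1]) (auto simp: S_def card_image_le)
  finally have ds: "out_degree G s \<le> card S + 1" by (simp add: out_degree_neighbours)
  have "neighbours G t \<subseteq> insert (p ! 0) ((\<lambda>j. p ! Suc j) ` T)"
  proof
    fix w assume w: "w \<in> neighbours G t"
    then have "w \<in> set p" using neighbours_subset set_p by blast
    then obtain j where j: "j < n" "w = p ! j" by (auto simp: n_def in_set_conv_nth)
    show "w \<in> insert (p ! 0) ((\<lambda>j. p ! Suc j) ` T)"
    proof (cases j)
      case (Suc m)
      then have "m \<in> T" using j w by (auto simp: T_def neighbours_def)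
      then show ?thesis using j Suc by auto
    qed (use j in auto)
  qed
  then have "card (neighbours G t) \<le> card (insert (p ! 0) ((\<lambda>j. p ! Suc j) ` T))"
    by (intro card_mono) (auto simp: T_def)
  also have "\<dots> \<le> card T + 1"
    by (rule order.trans[OF card_insert_le_m1]) (auto simp: T_def card_image_le)
  finally have "out_degree G t \<le> card T + 1" by (simp add: out_degree_neighbours)
  with ds ST n n_i show ?thesis by linarith
qed

definition add_edge :: "'a pair_pre_digraph \<Rightarrow> 'a \<Rightarrow> 'a \<Rightarrow> 'a pair_pre_digraph" where
  "add_edge G u v = \<lparr> pverts = pverts G, parcs = parcs G \<union> {(u, v), (v, u)} \<rparr>"

lemma successively_or_split:
  assumes "successively (\<lambda>x y. P x y \<or> Q x y) p"
  shows "successively P p \<or> (\<exists>xs x y ys. p = xs @ x # y # ys \<and> Q x y)"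
  using assms
proof (induction p rule: induct_list012)
  case (3 a b zs)
  show ?case
  proof (cases "Q a b")
    case True
    then show ?thesis by (intro disjI2 exI[of _ "[]"] exI[of _ a] exI[of _ b] exI[of _ zs]) simp
  next
    case False
    then have "P a b" using 3 by auto
    have "successively P (b # zs) \<or> (\<exists>xs x y ys. b # zs = xs @ x # y # ys \<and> Q x y)"
      using 3 by auto
    then show ?thesis
    proof
      assume "\<exists>xs x y ys. b # zs = xs @ x # y # ys \<and> Q x y"
      then obtain xs x y ys where "b # zs = xs @ x # y # ys" "Q x y" by blast
      then show ?thesis by (intro disjI2 exI[of _ "a # xs"] exI[of _ x] exI[of _ y] exI[of _ ys]) simp
    qed (use \<open>P a b\<close> in simp)
  qed
qed auto

text \<open>
  This is the step of the Bondy-Chvatal closure for Hamilton-connectedness: a Hamilton path between two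
  vertices that \<open>G\<close> does not join by one has to pass through the new edge, so rotation applies to it.
\<close>

lemma degree_sum_if_add_edge_hamilton_connected:
  assumes G: "pair_graph G" and uv: "u \<noteq> v" "\<not> adj G u v"
    and not_hc: "\<not> hamilton_connected G" and hc: "hamilton_connected (add_edge G u v)"
  shows "out_degree G u + out_degree G v \<le> card (pverts G)"
proof -
  interpret pair_graph G by fact
  obtain x y where xy: "x \<in> pverts G" "y \<in> pverts G" "x \<noteq> y"
    and no_path: "\<And>q. hamilton_path q G \<Longrightarrow> hd q = x \<Longrightarrow> last q = y \<Longrightarrow> False"
    using not_hc unfolding hamilton_connected_def by blast
  obtain p where p: "hamilton_path p (add_edge G u v)" "hd p = x" "last p = y"
    using hc xy unfolding hamilton_connected_def by (auto simp: add_edge_def)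
  let ?new = "\<lambda>x y. (x, y) \<in> {(u, v), (v, u)}"
  have "adj (add_edge G u v) = (\<lambda>x y. adj G x y \<or> ?new x y)"
    by (auto simp: add_edge_def fun_eq_iff)
  then have p': "p \<noteq> []" "distinct p" "set p = pverts G"
    and succ: "successively (\<lambda>x y. adj G x y \<or> ?new x y) p"
    using p(1) by (simp_all only: hamilton_path_iff) (simp_all add: add_edge_def)
  have "\<not> successively (adj G) p" using p' p no_path by (auto simp: hamilton_path_iff)
  then obtain xs s t ys where split: "p = xs @ s # t # ys" and st: "?new s t"
    using successively_or_split[OF succ] by blast
  have clean: "successively (adj G) zs"
    if new: "successively (\<lambda>x y. adj G x y \<or> ?new x y) zs" and missing: "s \<notin> set zs \<or> t \<notin> set zs" for zs
  proof (rule ccontr)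
    assume "\<not> successively (adj G) zs"
    then obtain as x y bs where "zs = as @ x # y # bs" "?new x y"
      using successively_or_split[OF new] by blast
    then show False using missing st by auto
  qed
  have "successively (\<lambda>x y. adj G x y \<or> ?new x y) ((xs @ [s]) @ (t # ys))"
    using succ split by simp
  then have "successively (\<lambda>x y. adj G x y \<or> ?new x y) (xs @ [s])"
    "successively (\<lambda>x y. adj G x y \<or> ?new x y) (t # ys)"
    unfolding successively_append_iff by blast+
  moreover have "t \<notin> set (xs @ [s])" "s \<notin> set (t # ys)" using p'(2) split by auto
  ultimately have walks: "successively (adj G) (xs @ [s])" "successively (adj G) (t # ys)"
    using clean by blast+
  have "hd (xs @ [s]) = x" "last (t # ys) = y" using p(2,3) split by (cases xs; simp)+
  then have "\<not> (\<exists>q. hamilton_path q G \<and> hd q = hd (xs @ [s]) \<and> last q = last (t # ys))"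
    using no_path by blast
  moreover have "\<not> adj G s t" using st uv adj_sym by blast
  ultimately have "out_degree G s + out_degree G t \<le> card (pverts G)"
    using rotation_degree_sum[OF G _ _ walks] p' unfolding split by blast
  then show ?thesis using st by auto
qed

lemma complete_hamilton_connected:
  assumes "finite (pverts G)" and complete: "\<And>u v. u \<in> pverts G \<Longrightarrow> v \<in> pverts G \<Longrightarrow> u \<noteq> v \<Longrightarrow> adj G u v"
  shows "hamilton_connected G"
  unfolding hamilton_connected_def
proof (intro ballI impI)
  fix u v assume uv: "u \<in> pverts G" "v \<in> pverts G" "u \<noteq> v"
  obtain zs where zs: "set zs = pverts G - {u, v}" "distinct zs"
    using finite_distinct_list[of "pverts G - {u, v}"] assms(1) by blast
  have succ: "successively (adj G) p" if "distinct p" "set p \<subseteq> pverts G" for p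
    using that by (induction p rule: induct_list012) (simp_all add: complete)
  have "distinct (u # zs @ [v])" "set (u # zs @ [v]) = pverts G" using uv zs by auto
  then have "hamilton_path (u # zs @ [v]) G" using succ unfolding hamilton_path_iff by blast
  then show "\<exists>p. hamilton_path p G \<and> hd p = u \<and> last p = v"
    by (intro exI[of _ "u # zs @ [v]"]) auto
qed

text \<open>
  Add edges as long as the graph does not become Hamilton-connected; degrees only grow, so it suffices to
  treat the resulting graph \<open>H\<close>, where \<open>d(u) + d(v) \<le> n\<close> for all nonadjacent \<open>u\<close>, \<open>v\<close>. Choose such a pair
  with the largest degree sum and \<open>d(u) \<le> d(v)\<close>, and let \<open>k = d(u)\<close>. By maximality every non-neighbour of \<open>v\<close>
  has degree at most \<open>k\<close>, and every non-neighbour of \<open>u\<close> has degree at most \<open>d(v) \<le> n - k\<close>.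
\<close>

lemma degree_sequence_not_hamilton_connected:
  assumes G: "pair_graph G" and not_hc: "\<not> hamilton_connected G"
  obtains k u where "2 * k \<le> card (pverts G)" and "u \<in> pverts G" "out_degree G u \<le> k"
    and "k - 1 \<le> card {v \<in> pverts G. out_degree G v \<le> k}"
    and "card (pverts G) - k \<le> card {v \<in> pverts G. out_degree G v \<le> card (pverts G) - k}"
proof -
  define V where "V = pverts G"
  note GD = pair_graphD[OF G, folded V_def]
  let ?g = "\<lambda>E. \<lparr>pverts = V, parcs = E\<rparr>"
  define \<E> where "\<E> = {E. parcs G \<subseteq> E \<and> E \<subseteq> V \<times> V \<and> sym E \<and> irrefl E \<and> \<not> hamilton_connected (?g E)}"
  have "G = ?g (parcs G)" by (simp add: V_def)
  then have mem: "parcs G \<in> \<E>" using GD not_hc by (auto simp: \<E>_def)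
  have "finite \<E>"
    by (rule finite_subset[of _ "Pow (V \<times> V)"]) (use GD in \<open>auto simp: \<E>_def\<close>)
  then obtain E where E: "E \<in> \<E>" and E_max: "\<And>E'. E' \<in> \<E> \<Longrightarrow> E \<subseteq> E' \<Longrightarrow> E' = E"
    using finite_has_maximal[of \<E>] mem by blast
  define H where "H = ?g E"
  have H: "pair_graph H" using E GD by (auto simp: \<E>_def H_def intro!: pair_graphI)
  have verts_H: "pverts H = V" and arcs_H: "parcs H = E" by (simp_all add: H_def)
  interpret H: pair_graph H by fact
  let ?n = "card V"
  let ?d = "out_degree H"
  have H_not_hc: "\<not> hamilton_connected H" using E by (simp add: \<E>_def H_def)
  have sum_le: "?d u + ?d v \<le> ?n" if uv: "u \<in> V" "v \<in> V" "u \<noteq> v" "\<not> adj H u v" for u v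
  proof -
    have "E \<union> {(u, v), (v, u)} \<notin> \<E>" using E_max uv(4) arcs_H by blast
    moreover have "sym (E \<union> {(u, v), (v, u)})" using E by (auto simp: \<E>_def sym_def)
    moreover have "irrefl (E \<union> {(u, v), (v, u)})" using E uv by (auto simp: \<E>_def irrefl_def)
    ultimately have "hamilton_connected (add_edge H u v)"
      using E uv by (auto simp: \<E>_def add_edge_def H_def)
    then show ?thesis
      using degree_sum_if_add_edge_hamilton_connected[OF H uv(3,4) H_not_hc] by (simp add: verts_H)
  qed
  define N where "N = {(u, v). u \<in> V \<and> v \<in> V \<and> u \<noteq> v \<and> \<not> adj H u v}"
  have "N \<noteq> {}"
    using complete_hamilton_connected[of H] H_not_hc GD(1) by (auto simp: N_def verts_H)
  have "finite N" by (rule finite_subset[of _ "V \<times> V"]) (use GD in \<open>auto simp: N_def\<close>)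
  let ?s = "\<lambda>(u, v). ?d u + ?d v"
  obtain e where "e \<in> N" and e_max: "\<And>e'. e' \<in> N \<Longrightarrow> ?s e' \<le> ?s e"
  proof -
    have "Max (?s ` N) \<in> ?s ` N" using \<open>finite N\<close> \<open>N \<noteq> {}\<close> by (intro Max_in) auto
    then obtain e where "e \<in> N" and e: "Max (?s ` N) = ?s e" by blast
    moreover have "?s e' \<le> ?s e" if "e' \<in> N" for e'
      unfolding e[symmetric] using that \<open>finite N\<close> by (intro Max_ge) auto
    ultimately show thesis using that by blast
  qed
  then obtain u v where uv: "(u, v) \<in> N" and le: "?d u \<le> ?d v"
    and uv_max: "\<And>u' v'. (u', v') \<in> N \<Longrightarrow> ?d u' + ?d v' \<le> ?d u + ?d v"
  proof -
    obtain a b where e: "e = (a, b)" by fastforce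
    have "(b, a) \<in> N" using \<open>e \<in> N\<close> H.adj_sym by (auto simp: N_def e)
    moreover have "?d u' + ?d v' \<le> ?d a + ?d b" if "(u', v') \<in> N" for u' v'
      using e_max[OF that] by (simp add: e)
    ultimately show thesis
      using that[of a b] that[of b a] \<open>e \<in> N\<close> unfolding e
      by (cases "?d a \<le> ?d b") (simp_all add: add.commute)
  qed
  define k where "k = ?d u"
  have uv': "u \<in> V" "v \<in> V" "u \<noteq> v" "\<not> adj H u v" using uv by (auto simp: N_def)
  have kv: "k + ?d v \<le> ?n" using sum_le[OF uv'] by (simp add: k_def)
  have deg_le: "out_degree G w \<le> ?d w" for w
    unfolding out_degree_neighbours
    by (rule card_mono[OF H.finite_neighbours]) (use E in \<open>auto simp: neighbours_def arcs_H \<E>_def\<close>)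
  have card_non: "card (V - {w} - neighbours H w) = ?n - 1 - ?d w" if "w \<in> V" for w
    using that H.neighbours_subset[of w] GD(1)
    by (subst card_Diff_subset) (auto simp: verts_H out_degree_neighbours H.finite_neighbours)
  have "V - {v} - neighbours H v \<subseteq> {w \<in> V. out_degree G w \<le> k}"
  proof
    fix w assume w: "w \<in> V - {v} - neighbours H v"
    then have "(w, v) \<in> N" using uv' H.adj_sym by (auto simp: N_def neighbours_def)
    then show "w \<in> {w \<in> V. out_degree G w \<le> k}"
      using w uv_max deg_le[of w] by (fastforce simp: k_def)
  qed
  then have "card (V - {v} - neighbours H v) \<le> card {w \<in> V. out_degree G w \<le> k}"
    using GD(1) by (intro card_mono) auto
  then have c1: "k - 1 \<le> card {w \<in> V. out_degree G w \<le> k}" using card_non[OF uv'(2)] kv by simp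
  have "insert u (V - {u} - neighbours H u) \<subseteq> {w \<in> V. out_degree G w \<le> ?n - k}"
  proof
    fix w assume w: "w \<in> insert u (V - {u} - neighbours H u)"
    show "w \<in> {w \<in> V. out_degree G w \<le> ?n - k}"
    proof (cases "w = u")
      case True
      then show ?thesis using le kv uv' deg_le[of u] by (auto simp: k_def)
    next
      case False
      then have "(u, w) \<in> N" using w uv' by (auto simp: N_def neighbours_def)
      then show ?thesis using uv_max[of u w] w uv' deg_le[of w] kv by (auto simp: k_def)
    qed
  qed
  then have "card (insert u (V - {u} - neighbours H u)) \<le> card {w \<in> V. out_degree G w \<le> ?n - k}"
    using GD(1) by (intro card_mono) auto
  moreover have "?d u \<le> ?n - 1" using H.degree_le uv' by (simp add: verts_H)
  moreover have "?n > 0" using uv' GD(1) by (auto simp: card_gt_0_iff)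
  ultimately have c2: "?n - k \<le> card {w \<in> V. out_degree G w \<le> ?n - k}"
    using card_non[OF uv'(1)] GD(1) by (simp add: k_def)
  show thesis
    using that[of k u] c1 c2 kv le uv'(1) deg_le[of u] by (simp add: k_def V_def)
qed


section \<open>Bounds for the signless Laplacian radius\<close>

lemma vertex_list:
  assumes "finite (pverts G)"
  shows "distinct (vertex_list G)" "set (vertex_list G) = pverts G"
    "length (vertex_list G) = card (pverts G)"
proof -
  have "\<exists>vs. distinct vs \<and> set vs = pverts G" using finite_distinct_list[OF assms] by blast
  from someI_ex[OF this] show 1: "distinct (vertex_list G)" and 2: "set (vertex_list G) = pverts G"
    by (simp_all add: vertex_list_def)
  show "length (vertex_list G) = card (pverts G)" using distinct_card[OF 1] 2 by simp
qed

lemma radius_le_of_positive_test_vector: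
  assumes G: "pair_graph G" and ne: "pverts G \<noteq> {}"
    and pos: "\<And>v. v \<in> pverts G \<Longrightarrow> x v > 0"
    and le: "\<And>v. v \<in> pverts G \<Longrightarrow>
      real (out_degree G v) * x v + (\<Sum>w\<in>neighbours G v. x w) \<le> c * x v"
  shows "signless_laplacian_radius G \<le> c"
proof -
  interpret pair_graph G by fact
  define n where "n = card (pverts G)"
  define vs where "vs = vertex_list G"
  note vs = vertex_list[OF pair_finite_verts, folded vs_def n_def]
  let ?Q = "signless_laplacian G"
  have Q: "?Q \<in> carrier_mat n n"
    by (simp add: signless_laplacian_def degree_mat_def adjacency_mat_def n_def)
  have n: "n > 0" using ne by (simp add: n_def card_gt_0_iff)
  have entry: "?Q $$ (i, j) =
      (if i = j then real (out_degree G (vs ! i)) else 0) + (if adj G (vs ! i) (vs ! j) then 1 else 0)"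
    if "i < n" "j < n" for i j
    using that by (simp add: signless_laplacian_def degree_mat_def adjacency_mat_def n_def vs_def)
  have mem: "vs ! i \<in> pverts G" if "i < n" for i using nth_mem[of i vs] that unfolding vs(2,3) .
  have bij: "bij_betw ((!) vs) {..<n} (pverts G)" using vs by (intro bij_betw_nth) simp_all
  have row: "(\<Sum>j<n. ?Q $$ (i, j) * x (vs ! j)) \<le> c * x (vs ! i)" if i: "i < n" for i
  proof -
    have "(\<Sum>j<n. ?Q $$ (i, j) * x (vs ! j)) =
        (\<Sum>j<n. (if i = j then real (out_degree G (vs ! i)) * x (vs ! j) else 0)) +
        (\<Sum>j<n. if adj G (vs ! i) (vs ! j) then x (vs ! j) else 0)"
      unfolding sum.distrib[symmetric]
      by (intro sum.cong refl) (simp add: entry[OF i] distrib_right)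
    also have "(\<Sum>j<n. (if i = j then real (out_degree G (vs ! i)) * x (vs ! j) else 0)) =
        real (out_degree G (vs ! i)) * x (vs ! i)"
      using i by simp
    also have "(\<Sum>j<n. if adj G (vs ! i) (vs ! j) then x (vs ! j) else 0) =
        (\<Sum>w\<in>pverts G. if adj G (vs ! i) w then x w else 0)"
      by (rule sum.reindex_bij_betw[OF bij])
    also have "\<dots> = (\<Sum>w\<in>{w \<in> pverts G. adj G (vs ! i) w}. x w)"
      by (rule sum.inter_filter[OF pair_finite_verts, symmetric])
    also have "{w \<in> pverts G. adj G (vs ! i) w} = neighbours G (vs ! i)"
      unfolding neighbours_def using in_arcsD2 by blast
    finally show ?thesis using le[OF mem[OF i]] by simp
  qed
  have "\<mu> \<le> c" if "\<mu> \<in> spectrum ?Q" for \<mu>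
  proof (rule eigenvalue_le_of_positive_test_vector[OF Q _ _ row])
    show "?Q $$ (i, j) \<ge> 0" if "i < n" "j < n" for i j using that by (simp add: entry)
    show "x (vs ! i) > 0" if "i < n" for i using that by (intro pos mem)
    show "eigenvalue ?Q \<mu>" using that by (simp add: spectrum_def)
  qed
  moreover have "spectrum ?Q \<noteq> {}"
  proof (rule symmetric_real_mat_spectrum_nonempty[OF Q n])
    show "?Q $$ (i, j) = ?Q $$ (j, i)" if "i < n" "j < n" for i j
      using adj_sym[of "vs ! i" "vs ! j"] unfolding entry[OF that] entry[OF that(2,1)] by simp
  qed
  ultimately show ?thesis
    unfolding signless_laplacian_radius_def using card_finite_spectrum(1)[OF Q] by simp
qed

lemma card_arcs: "card (parcs G) = (\<Sum>v\<in>pverts G. out_degree G v)" if "pair_graph G"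
proof -
  interpret pair_graph G by fact
  have "parcs G = Sigma (pverts G) (neighbours G)"
    using in_arcsD1 by (auto simp: neighbours_def)
  then show ?thesis
    by (simp add: finite_neighbours out_degree_neighbours)
qed

text \<open>
  In the row of a vertex of degree \<open>d\<close>, let \<open>S\<close> be the sum of the degrees of its neighbours. Since no vertex is
  isolated, the \<open>n - 1 - d\<close> non-neighbours add at least 1 each, and the vertex itself \<open>d\<close>, to the total degree \<open>M\<close>, so
  \<open>S \<le> M - (n - 1)\<close>; trivially also \<open>S \<le> d (n - 1)\<close>. The first bound is good for large \<open>d\<close>, the second one
  for small \<open>d\<close>.
\<close>

lemma radius_le_size:
  assumes G: "pair_graph G" and n: "card (pverts G) \<ge> 2"
    and deg: "\<And>v. v \<in> pverts G \<Longrightarrow> out_degree G v \<ge> 1"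
  shows "signless_laplacian_radius G \<le>
    real (card (parcs G)) / (real (card (pverts G)) - 1) + real (card (pverts G)) - 2"
proof -
  interpret pair_graph G by fact
  define N where "N = real (card (pverts G)) - 1"
  define M where "M = real (card (parcs G))"
  have N: "N > 0" using n by (simp add: N_def)
  have "signless_laplacian_radius G \<le> M / N + N - 1"
  proof (rule radius_le_of_positive_test_vector[OF G, where x = "\<lambda>v. real (out_degree G v)"])
    show "pverts G \<noteq> {}" using n by auto
    show "real (out_degree G v) > 0" if "v \<in> pverts G" for v using deg[OF that] by simp
    fix v assume v: "v \<in> pverts G"
    define d where "d = real (out_degree G v)"
    define S where "S = (\<Sum>w\<in>neighbours G v. real (out_degree G w))"
    define U where "U = pverts G - {v} - neighbours G v"
    have d: "1 \<le> d" "d \<le> N" using deg[OF v] degree_le[OF v] n by (simp_all add: d_def N_def)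
    have deg_N: "real (out_degree G w) \<le> N" if "w \<in> pverts G" for w
      using degree_le[OF that] n by (simp add: N_def)
    have "S \<le> (\<Sum>w\<in>neighbours G v. N)"
      unfolding S_def using neighbours_subset[of v] by (intro sum_mono deg_N) blast
    then have S1: "S \<le> d * N" by (simp add: d_def out_degree_neighbours)
    have "card U = card (pverts G) - 1 - out_degree G v"
      unfolding U_def out_degree_neighbours
      by (simp only: card_Diff_subset[OF finite_neighbours neighbours_subset]
        card_Diff_singleton[OF v])
    then have "real (card U) = N - d" using degree_le[OF v] n by (simp add: N_def d_def)
    moreover have "(\<Sum>w\<in>U. real (out_degree G w)) \<ge> (\<Sum>w\<in>U. 1)"
      using deg by (intro sum_mono) (simp add: U_def)
    moreover have "M = (\<Sum>w\<in>pverts G. real (out_degree G w))"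
      by (simp add: M_def card_arcs[OF G])
    moreover have "\<dots> = d + (\<Sum>w\<in>pverts G - {v}. real (out_degree G w))"
      by (simp add: sum.remove[OF pair_finite_verts v] d_def)
    moreover have "(\<Sum>w\<in>pverts G - {v}. real (out_degree G w)) = (\<Sum>w\<in>U. real (out_degree G w)) + S"
      unfolding S_def U_def using neighbours_subset by (intro sum.subset_diff) simp_all
    ultimately have S2: "S \<le> M - N" by simp
    have "d * d + S \<le> (M / N + N - 1) * d"
    proof (cases "M / N - 1 \<le> d")
      case True
      have "0 \<le> (N - d) * (d - (M / N - 1))" using True d by (intro mult_nonneg_nonneg) auto
      also have "\<dots> = (M / N + N - 1) * d - d * d - (M - N)"
        using N by (simp add: field_simps)
      finally show ?thesis using S2 by simp
    next
      case False
      have "d * d + S \<le> d * (d + N)" using S1 by (simp add: algebra_simps)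
      also have "\<dots> \<le> d * (M / N + N - 1)" using False d by (intro mult_left_mono) auto
      finally show ?thesis by (simp add: mult.commute)
    qed
    then show "real (out_degree G v) * real (out_degree G v) +
        (\<Sum>w\<in>neighbours G v. real (out_degree G w)) \<le> (M / N + N - 1) * real (out_degree G v)"
      by (simp add: d_def S_def)
  qed
  then show ?thesis by (simp add: N_def M_def)
qed

text \<open>
  The test vector is \<open>y\<close> on the set \<open>L\<close> of vertices of small degree and 1 elsewhere: a vertex of \<open>L\<close> has few
  neighbours, and the others see small weights on \<open>L\<close>.
\<close>

lemma many_low_degrees_radius_le:
  fixes y c :: real
  assumes G: "pair_graph G" and L: "L \<subseteq> pverts G" "\<And>v. v \<in> L \<Longrightarrow> out_degree G v \<le> l"
    and s: "card (pverts G - L) = s" "s \<ge> 1" and y: "0 < y" "y \<le> 1"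
    and high: "real (card (pverts G)) - 1 + (real s - 1) + y * real (card L) \<le> c"
    and low: "2 * real l * y + (1 - y) * real s \<le> c * y"
  shows "signless_laplacian_radius G \<le> c"
proof -
  interpret pair_graph G by fact
  define x where "x v = (if v \<in> L then y else 1)" for v
  show ?thesis
  proof (rule radius_le_of_positive_test_vector[OF G, where x = x])
    show "pverts G \<noteq> {}" using s by auto
    show "x v > 0" for v using y by (simp add: x_def)
    fix v assume v: "v \<in> pverts G"
    have fin: "finite (neighbours G v)" by (rule finite_neighbours)
    show "real (out_degree G v) * x v + (\<Sum>w\<in>neighbours G v. x w) \<le> c * x v"
    proof (cases "v \<in> L")
      case True
      have deg: "real (out_degree G v) \<le> real l" using L(2)[OF True] by simp
      have "card (neighbours G v - L) \<le> s"
        unfolding s(1)[symmetric] using neighbours_subset[of v] by (intro card_mono) auto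
      then have out: "real (card (neighbours G v - L)) \<le> real s" by simp
      have "(\<Sum>w\<in>neighbours G v. x w) =
          (\<Sum>w\<in>neighbours G v. y + (if w \<in> L then 0 else 1 - y))"
        by (intro sum.cong) (auto simp: x_def)
      also have "\<dots> = real (out_degree G v) * y + (\<Sum>w\<in>neighbours G v. if w \<in> L then 0 else 1 - y)"
        by (simp add: sum.distrib out_degree_neighbours)
      also have "(\<Sum>w\<in>neighbours G v. if w \<in> L then 0 else 1 - y) =
          (\<Sum>w\<in>neighbours G v - L. 1 - y)"
        using fin by (intro sum.mono_neutral_cong_right) auto
      also have "\<dots> = (1 - y) * real (card (neighbours G v - L))" by simp
      also have "\<dots> \<le> (1 - y) * real s" using out y by (intro mult_left_mono) auto
      finally have "(\<Sum>w\<in>neighbours G v. x w) \<le> real (out_degree G v) * y + (1 - y) * real s"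
        by simp
      moreover have "real (out_degree G v) * y \<le> real l * y" using deg y by (intro mult_right_mono) auto
      ultimately show ?thesis using low True by (simp add: x_def)
    next
      case False
      have "(\<Sum>w\<in>neighbours G v. x w) \<le> (\<Sum>w\<in>pverts G - {v}. x w)"
        using neighbours_subset[of v] y by (intro sum_mono2) (auto simp: x_def)
      also have "\<dots> = (\<Sum>w\<in>pverts G. x w) - 1"
        using v False by (subst sum_diff1) (auto simp: x_def)
      also have "(\<Sum>w\<in>pverts G. x w) = (\<Sum>w\<in>pverts G - L. x w) + (\<Sum>w\<in>L. x w)"
        using L(1) by (intro sum.subset_diff) auto
      also have "(\<Sum>w\<in>L. x w) = y * real (card L)" by (simp add: x_def)
      also have "(\<Sum>w\<in>pverts G - L. x w) = real s" using s(1) by (simp add: x_def)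
      finally have "(\<Sum>w\<in>neighbours G v. x w) \<le> real s + y * real (card L) - 1" .
      moreover have "real (out_degree G v) \<le> real (card (pverts G)) - 1"
      proof -
        have "card (pverts G) \<ge> 1" using v by (simp add: Suc_le_eq card_gt_0_iff) auto
        then show ?thesis using degree_le[OF v] by simp
      qed
      ultimately show ?thesis using high False by (simp add: x_def)
    qed
  qed
qed


section \<open>Two vertices of degree three\<close>

text \<open>
  The situation left over when the degree sequence condition holds with \<open>k = 3\<close>.
\<close>

locale two_cubic_vertices = pair_graph G for G :: "'a pair_pre_digraph" +
  fixes a b :: 'a and n :: nat
  assumes ab: "a \<in> pverts G" "b \<in> pverts G" "a \<noteq> b"
    and deg_ab: "out_degree G a = 3" "out_degree G b = 3"
    and card_verts: "card (pverts G) = n" and n: "n \<ge> 13"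
begin

definition "rest = pverts G - {a, b}"

definition links :: "'a \<Rightarrow> real" where
  "links w = of_bool (adj G w a) + of_bool (adj G w b)"

lemma finite_rest [simp]: "finite rest" by (simp add: rest_def)

lemma card_rest: "real (card rest) = real n - 2"
  using ab n by (simp add: rest_def card_verts of_nat_diff)

lemma links_cases: obtains "links w = 0" | "links w = 1" | "links w = 2"
  by (cases "adj G w a"; cases "adj G w b") (auto simp: links_def)

lemma sum_links: "(\<Sum>w\<in>rest. links w) = (if adj G a b then 4 else 6)"
proof -
  have count: "(\<Sum>w\<in>rest. of_bool (adj G w z) :: real) = 3 - of_bool (adj G a b)"
    if z: "z = a \<and> y = b \<or> z = b \<and> y = a" for z y
  proof -
    have "(\<Sum>w\<in>rest. of_bool (adj G w z) :: real) = real (card {w \<in> rest. adj G w z})"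
      by (simp add: Collect_conj_eq Int_commute)
    also have "{w \<in> rest. adj G w z} = neighbours G z - {y}"
      using z neighbours_subset[of z] adj_sym by (auto simp: rest_def neighbours_def)
    also have "real (card \<dots>) = 3 - of_bool (y \<in> neighbours G z)"
    proof -
      have "card (neighbours G z) = 3" using deg_ab z by (auto simp: out_degree_neighbours)
      then show ?thesis by (simp add: card_Diff_singleton_if)
    qed
    also have "y \<in> neighbours G z \<longleftrightarrow> adj G a b"
      using z adj_sym by (auto simp: neighbours_def)
    finally show ?thesis .
  qed
  show ?thesis
    using count[of a b] count[of b a] by (simp add: links_def sum.distrib)
qed

text \<open>
  In the applications \<open>X\<close> consists of \<open>w\<close> itself and, if \<open>w\<close> is an end of the missing edge, of its other end. The
  left-hand side, the entry of \<open>Q x\<close> at \<open>w\<close>, is largest when \<open>w\<close> is joined to all of \<open>rest - X\<close>.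
\<close>

lemma row_le:
  assumes w: "w \<in> rest" and X: "X \<subseteq> rest" "neighbours G w \<inter> rest \<subseteq> rest - X"
    and x: "\<And>v. v \<in> pverts G \<Longrightarrow> x v \<ge> 0" "x a = e" "x b = e"
  shows "real (out_degree G w) * x w + (\<Sum>v\<in>neighbours G w. x v)
    \<le> (real n - 2 - real (card X) + links w) * x w + ((\<Sum>v\<in>rest. x v) - (\<Sum>v\<in>X. x v)) + links w * e"
proof -
  define K where "K = neighbours G w \<inter> rest"
  define T where "T = neighbours G w \<inter> {a, b}"
  have KT: "neighbours G w = K \<union> T" "K \<inter> T = {}"
    using neighbours_subset[of w] by (auto simp: K_def T_def rest_def)
  have fin: "finite K" "finite T" by (auto simp: K_def T_def)
  have sum_T: "(\<Sum>v\<in>T. f v) = of_bool (adj G w a) * f a + of_bool (adj G w b) * f b" for f :: "'a \<Rightarrow> real"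
    using ab(3) by (auto simp: T_def neighbours_def Int_insert_right)
  have "real (card T) = links w" using sum_T[of "\<lambda>_. 1"] by (simp add: links_def)
  moreover have "real (card K) \<le> real n - 2 - real (card X)"
  proof -
    have "card K \<le> card (rest - X)" using X by (intro card_mono) (auto simp: K_def)
    also have "card (rest - X) = card rest - card X"
      using X by (intro card_Diff_subset) (auto intro: finite_subset)
    finally show ?thesis using card_rest card_mono[OF finite_rest X(1)] by linarith
  qed
  ultimately have "real (out_degree G w) \<le> real n - 2 - real (card X) + links w"
    using fin KT by (simp add: out_degree_neighbours card_Un_disjoint)
  then have "real (out_degree G w) * x w \<le> (real n - 2 - real (card X) + links w) * x w"
    using x(1)[of w] w by (intro mult_right_mono) (auto simp: rest_def)
  moreover have "(\<Sum>v\<in>K. x v) \<le> (\<Sum>v\<in>rest - X. x v)"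
    using X x(1) by (intro sum_mono2) (auto simp: K_def rest_def)
  moreover have "(\<Sum>v\<in>rest - X. x v) = (\<Sum>v\<in>rest. x v) - (\<Sum>v\<in>X. x v)"
    using X by (intro sum_diff) auto
  moreover have "(\<Sum>v\<in>neighbours G w. x v) = (\<Sum>v\<in>K. x v) + (\<Sum>v\<in>T. x v)"
    using fin KT by (simp add: sum.union_disjoint)
  moreover have "(\<Sum>v\<in>T. x v) = links w * e"
    using x by (simp add: sum_T links_def algebra_simps)
  ultimately show ?thesis by linarith
qed

text \<open>
  Let \<open>e = 1 / (n - 1)\<close>. Raising the weight of a vertex by \<open>3/2 e\<close> for each link to \<open>a\<close> or \<open>b\<close> is the most
  that the rows of vertices without links allow: the four links together raise the sum by exactly the
  available \<open>6e\<close>. The weight \<open>1/6\<close> of \<open>a\<close> and \<open>b\<close> has to be large enough for their own rows and small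
  enough for the rows of their neighbours; for \<open>n = 13\<close> this means between about \<open>0.152\<close> and \<open>0.187\<close>.
\<close>

lemma adjacent_radius_le:
  assumes "adj G a b"
  shows "signless_laplacian_radius G \<le> 2 * real n - 6 + 6 / (real n - 1)"
proof -
  define N where "N = real n - 1"
  define e where "e = 1 / N"
  have N: "N \<ge> 12" using n by (simp add: N_def)
  have Ne: "N * e = 1" "0 < e" "e \<le> 1 / 12" using N by (auto simp: e_def field_simps)
  have Nec: "N * (e * c) = c" for c using Ne(1) by (simp flip: mult.assoc)
  \<comment> \<open>Once \<open>N * e\<close> is replaced by 1, the rows are linear in \<open>N\<close>, \<open>e\<close> and \<open>e * e\<close>; the chord through 0 and the
    tangent at \<open>1 / 12\<close> bound \<open>e * e\<close> well enough.\<close>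
  define q where "q = e * e"
  have q: "e * e = q" "e * (e * c) = q * c" for c by (simp_all add: q_def)
  have "(e - 1 / 12) * (e - 1 / 12) \<ge> 0" by simp
  then have "q \<ge> e / 6 - 1 / 144" by (simp add: q algebra_simps)
  moreover have "q \<le> e / 12" using mult_left_mono[of e "1 / 12" e] Ne(2,3) by (simp add: q_def)
  ultimately have sq: "q \<le> e / 12" "q \<ge> e / 6 - 1 / 144" by blast+
  define x where "x w = (if w \<in> {a, b} then 1 / 6 else 1 + links w * (3 / 2 * e))" for w
  let ?c = "2 * N - 4 + 6 * e"
  have links_nonneg: "links w \<ge> 0" for w by (simp add: links_def)
  have x_rest: "x w = 1 + links w * (3 / 2 * e)" if "w \<in> rest" for w using that by (simp add: x_def rest_def)
  have sum_x: "(\<Sum>w\<in>rest. x w) = N - 1 + 6 * e"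
  proof -
    have "(\<Sum>w\<in>rest. x w) = (\<Sum>w\<in>rest. 1 + links w * (3 / 2 * e))" by (intro sum.cong x_rest) auto
    also have "\<dots> = real (card rest) + (\<Sum>w\<in>rest. links w) * (3 / 2 * e)"
      by (simp only: sum.distrib sum_distrib_right) simp
    finally show ?thesis using assms by (simp add: sum_links card_rest N_def)
  qed
  have "signless_laplacian_radius G \<le> ?c"
  proof (rule radius_le_of_positive_test_vector[where x = x])
    show "pair_graph G" by unfold_locales
    show "pverts G \<noteq> {}" using ab by auto
    show pos: "x w > 0" for w
    proof -
      have "links w * (3 / 2 * e) \<ge> 0" using links_nonneg[of w] Ne(2) by simp
      moreover have "x w = 1 / 6 \<or> x w = 1 + links w * (3 / 2 * e)" by (simp add: x_def)
      ultimately show ?thesis by linarith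
    qed
    fix w assume w: "w \<in> pverts G"
    show "real (out_degree G w) * x w + (\<Sum>v\<in>neighbours G w. x v) \<le> ?c * x w"
    proof (cases "w \<in> rest")
      case True
      have "real (out_degree G w) * x w + (\<Sum>v\<in>neighbours G w. x v)
          \<le> (real n - 2 - real (card {w}) + links w) * x w + ((\<Sum>v\<in>rest. x v) - (\<Sum>v\<in>{w}. x v)) + links w * (1 / 6)"
        using True neighbours_subset[of w] less_imp_le[OF pos] by (intro row_le) (auto simp: x_def)
      also have "\<dots> = (N - 2 + links w) * x w + (N - 1 + 6 * e - x w) + links w / 6"
        by (simp add: sum_x N_def)
      also have "\<dots> \<le> ?c * x w"
        unfolding x_rest[OF True]
        by (rule links_cases[of w]; insert sq Ne(2,3) N;
          simp add: Ne(1) Nec q add_divide_distrib diff_divide_distrib algebra_simps)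
      finally show ?thesis .
    next
      case False
      then obtain y where wy: "w = a \<and> y = b \<or> w = b \<and> y = a" using w by (auto simp: rest_def)
      have deg: "out_degree G w = 3" using wy deg_ab by auto
      have y: "y \<in> neighbours G w" using wy assms adj_sym by (auto simp: neighbours_def)
      have "card (neighbours G w - {y}) = 2" using deg y by (simp add: out_degree_neighbours)
      moreover have "(\<Sum>v\<in>neighbours G w - {y}. x v) \<le> (\<Sum>v\<in>neighbours G w - {y}. 1 + 3 * e)"
      proof (rule sum_mono)
        fix v assume "v \<in> neighbours G w - {y}"
        then have "v \<in> rest" using wy neighbours_subset[of w] by (auto simp: rest_def)
        then show "x v \<le> 1 + 3 * e" using Ne(2) by (rule_tac links_cases[of v]) (auto simp: x_rest)
      qed
      moreover have "(\<Sum>v\<in>neighbours G w. x v) = x y + (\<Sum>v\<in>neighbours G w - {y}. x v)"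
        by (rule sum.remove[OF finite_neighbours y])
      moreover have x_yw: "x y = 1 / 6" "x w = 1 / 6" using wy by (auto simp: x_def)
      ultimately show ?thesis using deg N Ne by (simp add: x_yw)
    qed
  qed
  then show ?thesis by (simp add: N_def e_def)
qed

text \<open>
  Each link raises the weight of a vertex by \<open>14/9 e\<close>, and each end of the missing edge \<open>uv\<close> loses \<open>5/3 e\<close>. Six
  links and two ends change the sum by \<open>6 \<cdot> 14/9 e - 2 \<cdot> 5/3 e = 6e\<close>, which makes the rows without links
  and away from \<open>uv\<close> tight. Within this constraint the slope is nearly forced when \<open>n = 13\<close>: the rows
  of \<open>u\<close> and \<open>v\<close> bound it from above, those of the neighbours of \<open>a\<close> and \<open>b\<close> from below. The weight
  \<open>2/9\<close> of \<open>a\<close> and \<open>b\<close> lies between the bounds from their own rows (about \<open>0.216\<close> when \<open>n = 13\<close>) and from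
  those of their neighbours (about \<open>0.231\<close>). Other missing edges only decrease the entries of \<open>Q x\<close>.
\<close>

lemma missing_edge_radius_le:
  assumes not_adj: "\<not> adj G a b" and uv: "u \<in> rest" "v \<in> rest" "u \<noteq> v" "\<not> adj G u v"
  shows "signless_laplacian_radius G \<le> 2 * real n - 6 + 6 / (real n - 1)"
proof -
  define N where "N = real n - 1"
  define e where "e = 1 / N"
  have N: "N \<ge> 12" using n by (simp add: N_def)
  have Ne: "N * e = 1" "0 < e" "e \<le> 1 / 12" using N by (auto simp: e_def field_simps)
  have Nec: "N * (e * c) = c" for c using Ne(1) by (simp flip: mult.assoc)
  \<comment> \<open>Once \<open>N * e\<close> is replaced by 1, the rows are linear in \<open>N\<close>, \<open>e\<close> and \<open>e * e\<close>; the chord through 0 and the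
    tangent at \<open>1 / 12\<close> bound \<open>e * e\<close> well enough.\<close>
  define q where "q = e * e"
  have q: "e * e = q" "e * (e * c) = q * c" for c by (simp_all add: q_def)
  have "(e - 1 / 12) * (e - 1 / 12) \<ge> 0" by simp
  then have "q \<ge> e / 6 - 1 / 144" by (simp add: q algebra_simps)
  moreover have "q \<le> e / 12" using mult_left_mono[of e "1 / 12" e] Ne(2,3) by (simp add: q_def)
  ultimately have sq: "q \<le> e / 12" "q \<ge> e / 6 - 1 / 144" by blast+
  define x where "x w = (if w \<in> {a, b} then 2 / 9
    else 1 + links w * (14 / 9 * e) - (if w \<in> {u, v} then 5 / 3 * e else 0))" for w
  let ?c = "2 * N - 4 + 6 * e"
  have links_nonneg: "links w \<ge> 0" for w by (simp add: links_def)
  have x_rest: "x w = 1 + links w * (14 / 9 * e) - (if w \<in> {u, v} then 5 / 3 * e else 0)" if "w \<in> rest" for w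
    using that by (simp add: x_def rest_def)
  have sum_x: "(\<Sum>w\<in>rest. x w) = N - 1 + 6 * e"
  proof -
    have "(\<Sum>w\<in>rest. x w) = (\<Sum>w\<in>rest. 1 + links w * (14 / 9 * e) - (if w \<in> {u, v} then 5 / 3 * e else 0))"
      by (intro sum.cong x_rest) auto
    also have "\<dots> = real (card rest) + (\<Sum>w\<in>rest. links w) * (14 / 9 * e)
        - (\<Sum>w\<in>rest. if w \<in> {u, v} then 5 / 3 * e else 0)"
      by (simp only: sum.distrib sum_subtractf sum_distrib_right) simp
    also have "(\<Sum>w\<in>rest. if w \<in> {u, v} then 5 / 3 * e else 0) = (\<Sum>w\<in>{u, v}. 5 / 3 * e)"
      using uv by (intro sum.mono_neutral_cong_right) auto
    finally show ?thesis using not_adj uv(3) by (simp add: sum_links card_rest N_def)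
  qed
  have "signless_laplacian_radius G \<le> ?c"
  proof (rule radius_le_of_positive_test_vector[where x = x])
    show "pair_graph G" by unfold_locales
    show "pverts G \<noteq> {}" using ab by auto
    show pos: "x w > 0" for w
    proof -
      have "links w * (14 / 9 * e) \<ge> 0" using links_nonneg[of w] Ne(2) by simp
      moreover have "x w = 2 / 9 \<or> x w = 1 + links w * (14 / 9 * e) \<or>
          x w = 1 + links w * (14 / 9 * e) - 5 / 3 * e" by (simp add: x_def)
      ultimately show ?thesis using Ne(3) by linarith
    qed
    fix w assume w: "w \<in> pverts G"
    show "real (out_degree G w) * x w + (\<Sum>v\<in>neighbours G w. x v) \<le> ?c * x w"
    proof (cases "w \<in> rest")
      case rest: True
      show ?thesis
      proof (cases "w \<in> {u, v}")
        case True
        then obtain z where z: "{u, v} = {w, z}" "z \<noteq> w" "z \<in> rest" "z \<in> {u, v}" and "\<not> adj G w z"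
          using uv adj_sym by (cases "w = u") auto
        then have "real (out_degree G w) * x w + (\<Sum>v\<in>neighbours G w. x v)
            \<le> (real n - 2 - real (card {w, z}) + links w) * x w
              + ((\<Sum>v\<in>rest. x v) - (\<Sum>v\<in>{w, z}. x v)) + links w * (2 / 9)"
          using rest neighbours_subset[of w] less_imp_le[OF pos]
          by (intro row_le) (auto simp: x_def neighbours_def)
        also have "\<dots> = (N - 3 + links w) * x w + (N - 1 + 6 * e - (x w + x z)) + links w * (2 / 9)"
          using z(2) by (simp add: sum_x N_def)
        also have "\<dots> \<le> ?c * x w"
        proof -
          have xw: "x w = 1 + links w * (14 / 9 * e) - 5 / 3 * e" using x_rest[OF rest] True by simp
          have "x z = 1 + links z * (14 / 9 * e) - 5 / 3 * e" using x_rest[OF z(3)] z(4) by simp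
          then have xz: "x z \<ge> 1 - 5 / 3 * e" using links_nonneg[of z] Ne(2) by simp
          show ?thesis
            by (rule links_cases[of w]; insert sq Ne(2,3) N xz;
              simp add: xw Ne(1) Nec q add_divide_distrib diff_divide_distrib algebra_simps)
        qed
        finally show ?thesis .
      next
        case False
        have "real (out_degree G w) * x w + (\<Sum>v\<in>neighbours G w. x v)
            \<le> (real n - 2 - real (card {w}) + links w) * x w + ((\<Sum>v\<in>rest. x v) - (\<Sum>v\<in>{w}. x v)) + links w * (2 / 9)"
          using rest neighbours_subset[of w] less_imp_le[OF pos] by (intro row_le) (auto simp: x_def)
        also have "\<dots> = (N - 2 + links w) * x w + (N - 1 + 6 * e - x w) + links w * (2 / 9)"
          by (simp add: sum_x N_def)
        also have "\<dots> \<le> ?c * x w"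
        proof -
          have xw: "x w = 1 + links w * (14 / 9 * e)" using x_rest[OF rest] False by simp
          show ?thesis
            by (rule links_cases[of w]; insert sq Ne(2,3) N;
              simp add: xw Ne(1) Nec q add_divide_distrib diff_divide_distrib algebra_simps)
        qed
        finally show ?thesis .
      qed
    next
      case False
      then have wab: "w = a \<or> w = b" using w by (auto simp: rest_def)
      have deg: "out_degree G w = 3" using wab deg_ab by auto
      have "(\<Sum>z\<in>neighbours G w. x z) \<le> (\<Sum>z\<in>neighbours G w. 1 + 28 / 9 * e)"
      proof (rule sum_mono)
        fix z assume z: "z \<in> neighbours G w"
        then have "z \<noteq> a" "z \<noteq> b"
          using wab not_adj adj_sym no_loops' by (auto simp: neighbours_def)
        then have "z \<in> rest" using z neighbours_subset[of w] by (auto simp: rest_def)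
        then show "x z \<le> 1 + 28 / 9 * e"
          using Ne(2) by (rule_tac links_cases[of z]) (auto simp: x_rest)
      qed
      moreover have xw: "x w = 2 / 9" using wab by (auto simp: x_def)
      ultimately show ?thesis using deg N Ne by (simp add: xw out_degree_neighbours)
    qed
  qed
  then show ?thesis by (simp add: N_def e_def)
qed

end


section \<open>Counting edges and recognizing the extremal graph\<close>

text \<open>
  The \<open>k\<close> vertices on which nothing is known have degree at most \<open>n - 1\<close>.
\<close>

lemma degree_sum_le:
  assumes G: "pair_graph G" and n: "card (pverts G) = n" and k: "1 \<le> k" "2 * k \<le> n"
    and low: "k - 1 \<le> card {v \<in> pverts G. out_degree G v \<le> k}"
    and mid: "n - k \<le> card {v \<in> pverts G. out_degree G v \<le> n - k}"
  shows "int (card (parcs G)) \<le>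
    (int k - 1) * int k + (int n - 2 * int k + 1) * (int n - int k) + int k * (int n - 1)"
proof -
  interpret pair_graph G by fact
  let ?d = "out_degree G" and ?V = "pverts G"
  let ?B = "{v \<in> ?V. ?d v \<le> n - k}"
  obtain A where A: "A \<subseteq> {v \<in> ?V. ?d v \<le> k}" "card A = k - 1" "finite A"
    using obtain_subset_with_card_n[OF low] by blast
  have "A \<subseteq> ?B" using A(1) k by auto
  then have "n - k - (k - 1) \<le> card (?B - A)"
    using mid A by (subst card_Diff_subset) auto
  then obtain C where C: "C \<subseteq> ?B - A" "card C = n - k - (k - 1)" "finite C"
    using obtain_subset_with_card_n by blast
  define D where "D = ?V - (A \<union> C)"
  have AC: "A \<union> C \<subseteq> ?V" "A \<inter> C = {}" using A C by auto
  have card_D: "card D = k"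
  proof -
    have "card (A \<union> C) = n - k" using A C AC k by (subst card_Un_disjoint) auto
    then show ?thesis unfolding D_def using AC k n A(3) C(3) by (subst card_Diff_subset) auto
  qed
  have "card (parcs G) = (\<Sum>v\<in>D. ?d v) + (\<Sum>v\<in>A \<union> C. ?d v)"
    unfolding card_arcs[OF G] D_def using AC by (intro sum.subset_diff) auto
  also have "(\<Sum>v\<in>A \<union> C. ?d v) = (\<Sum>v\<in>A. ?d v) + (\<Sum>v\<in>C. ?d v)"
    using A C AC by (intro sum.union_disjoint) auto
  also have "(\<Sum>v\<in>A. ?d v) \<le> card A * k"
    using A(1) by (intro order.trans[OF sum_bounded_above[of A ?d k]]) auto
  also have "(\<Sum>v\<in>C. ?d v) \<le> card C * (n - k)"
    using C(1) by (intro order.trans[OF sum_bounded_above[of C ?d "n - k"]]) auto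
  also have "(\<Sum>v\<in>D. ?d v) \<le> card D * (n - 1)"
    using degree_le n by (intro order.trans[OF sum_bounded_above[of D ?d "n - 1"]]) (auto simp: D_def)
  finally have "card (parcs G) \<le> k * (n - 1) + ((k - 1) * k + (n - k - (k - 1)) * (n - k))"
    using A C card_D by simp
  then have "int (card (parcs G)) \<le> int (k * (n - 1) + ((k - 1) * k + (n - k - (k - 1)) * (n - k)))"
    by (simp only: of_nat_le_iff)
  also have "\<dots> = int k * (int n - 1) + ((int k - 1) * int k + (int n - 2 * int k + 1) * (int n - int k))"
  proof -
    have "int (n - 1) = int n - 1" "int (k - 1) = int k - 1" "int (n - k) = int n - int k"
      "int (n - k - (k - 1)) = int n - 2 * int k + 1"
      using k by linarith+
    then show ?thesis by (simp only: of_nat_add of_nat_mult)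
  qed
  finally show ?thesis by simp
qed

text \<open>
  The last hypothesis amounts to \<open>(k - 3) (2n - 3k - 6) \<le> 7\<close>. By \<open>n \<ge> 2k\<close> the second factor is at least
  \<open>k - 6\<close>, so \<open>k \<ge> 8\<close> is impossible; the remaining values of \<open>k\<close> are checked one by one.
\<close>

lemma large_size_cases:
  fixes k n :: int
  assumes "3 \<le> k" "2 * k \<le> n" "13 \<le> n"
    and "(n - 1) * (n - 4) + 6 < (k - 1) * k + (n - 2 * k + 1) * (n - k) + k * (n - 1)"
  shows "k = 3 \<or> k = 6 \<and> n = 13 \<or> k = 7 \<and> n = 14"
proof -
  have le: "(k - 3) * (2 * n - 3 * k - 6) \<le> 7" using assms(4) by (simp add: algebra_simps)
  have "k < 8"
  proof (rule ccontr)
    assume "\<not> k < 8"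
    then have "(k - 3) * (2 * n - 3 * k - 6) \<ge> 5 * 2" using assms(2) by (intro mult_mono) auto
    then show False using le by simp
  qed
  then consider "k = 3" | "k = 4" | "k = 5" | "k = 6" | "k = 7" using assms(1) by linarith
  then show ?thesis using le assms(2,3) by cases auto
qed

lemma digraph_iso_of_bij:
  assumes G: "pair_graph G" and H: "parcs H \<subseteq> pverts H \<times> pverts H"
    and bij: "bij_betw h (pverts G) (pverts H)"
    and adj: "\<And>u v. u \<in> pverts G \<Longrightarrow> v \<in> pverts G \<Longrightarrow> adj H (h u) (h v) \<longleftrightarrow> adj G u v"
  shows "digraph_iso (with_proj G) (with_proj H)"
proof -
  interpret pair_graph G by fact
  define f where "f = \<lparr> iso_verts = h, iso_arcs = map_prod h h, iso_head = snd, iso_tail = fst \<rparr>"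
  have inj: "inj_on h (pverts G)" and surj: "h ` pverts G = pverts H"
    using bij by (auto simp: bij_betw_def)
  have sub: "parcs G \<subseteq> pverts G \<times> pverts G" by (rule pair_graphD[OF G])
  have "inj_on (map_prod h h) (parcs G)"
    by (rule inj_on_subset[OF map_prod_inj_on[OF inj inj] sub])
  then have "digraph_isomorphism f"
    unfolding digraph_isomorphism_def using inj wf_digraph_axioms by (auto simp: f_def)
  moreover have "map_prod h h ` parcs G = parcs H"
  proof
    show "map_prod h h ` parcs G \<subseteq> parcs H" using sub adj by auto
    show "parcs H \<subseteq> map_prod h h ` parcs G"
    proof
      fix e assume e: "e \<in> parcs H"
      then obtain x y where xy: "e = (x, y)" "x \<in> pverts H" "y \<in> pverts H" using H by (cases e) auto
      then obtain u v where "u \<in> pverts G" "v \<in> pverts G" "x = h u" "y = h v" using surj by blast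
      then have "e = map_prod h h (u, v)" "(u, v) \<in> parcs G" using e xy adj by auto
      then show "e \<in> map_prod h h ` parcs G" by blast
    qed
  qed
  then have "with_proj H = app_iso f (with_proj G)"
    using surj by (simp add: app_iso_def with_proj_def f_def)
  ultimately show ?thesis unfolding digraph_iso_def by blast
qed

lemma verts_S3_graph: "pverts (S3_graph n) = {..<3} <+> ({..<n - 5} <+> {..<2} \<times> {..<1})"
  by (simp add: S3_graph_def graph_join_def disjoint_union_def complete_graph_def graph_copies_def)

lemma adj_S3_graph:
  "adj (S3_graph n) (Inl i) (Inl j) \<longleftrightarrow> i < 3 \<and> j < 3 \<and> i \<noteq> j"
  "adj (S3_graph n) (Inl i) (Inr y) \<longleftrightarrow> i < 3 \<and> y \<in> {..<n - 5} <+> {..<2} \<times> {..<1}"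
  "adj (S3_graph n) (Inr y) (Inl i) \<longleftrightarrow> i < 3 \<and> y \<in> {..<n - 5} <+> {..<2} \<times> {..<1}"
  "adj (S3_graph n) (Inr (Inl k)) (Inr (Inl l)) \<longleftrightarrow> k < n - 5 \<and> l < n - 5 \<and> k \<noteq> l"
  "\<not> adj (S3_graph n) (Inr (Inl k)) (Inr (Inr x))"
  "\<not> adj (S3_graph n) (Inr (Inr x)) (Inr (Inl k))"
  "\<not> adj (S3_graph n) (Inr (Inr x)) (Inr (Inr z))"
  by (auto simp: S3_graph_def graph_join_def disjoint_union_def complete_graph_def graph_copies_def)

context two_cubic_vertices begin

text \<open>
  A neighbour of \<open>a\<close> or \<open>b\<close> is also adjacent to the \<open>n - 3\<close> other vertices of \<open>rest\<close>, so its degree is at least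
  \<open>n - 2\<close>. At most three vertices have such a degree, and \<open>a\<close> and \<open>b\<close> have three neighbours each.
\<close>

lemma same_neighbours:
  assumes not_adj: "\<not> adj G a b"
    and complete: "\<And>u v. u \<in> rest \<Longrightarrow> v \<in> rest \<Longrightarrow> u \<noteq> v \<Longrightarrow> adj G u v"
    and mid: "n - 3 \<le> card {v \<in> pverts G. out_degree G v \<le> n - 3}"
  shows "neighbours G a = neighbours G b"
proof -
  define W where "W = {v \<in> pverts G. \<not> out_degree G v \<le> n - 3}"
  have "W = pverts G - {v \<in> pverts G. out_degree G v \<le> n - 3}" by (auto simp: W_def)
  then have "card W = n - card {v \<in> pverts G. out_degree G v \<le> n - 3}"
    by (simp add: card_Diff_subset card_verts)
  then have W: "card W \<le> 3" using mid by simp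
  have "neighbours G z = W" if z: "z \<in> {a, b}" for z
  proof (rule card_seteq)
    show "finite W" by (simp add: W_def)
    show "card W \<le> card (neighbours G z)" using W z deg_ab by (auto simp: out_degree_neighbours)
    show "neighbours G z \<subseteq> W"
    proof
      fix w assume w: "w \<in> neighbours G z"
      then have wz: "adj G w z" using adj_sym by (simp add: neighbours_def)
      have "w \<noteq> a" "w \<noteq> b" using w z not_adj adj_sym no_loops' by (auto simp: neighbours_def)
      then have w_rest: "w \<in> rest" using w neighbours_subset[of z] by (auto simp: rest_def)
      have "insert z (rest - {w}) \<subseteq> neighbours G w"
        using wz complete[OF w_rest] by (auto simp: neighbours_def)
      then have "card (insert z (rest - {w})) \<le> card (neighbours G w)"
        by (intro card_mono finite_neighbours)
      moreover have "card rest = n - 2" using card_rest n by linarith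
      then have "card (insert z (rest - {w})) = n - 2"
        using w_rest z n by (subst card_insert_disjoint) (auto simp: rest_def)
      ultimately show "w \<in> W" using w_rest n by (auto simp: W_def rest_def out_degree_neighbours)
    qed
  qed
  then show ?thesis by simp
qed

lemma iso_S3:
  assumes not_adj: "\<not> adj G a b"
    and complete: "\<And>u v. u \<in> rest \<Longrightarrow> v \<in> rest \<Longrightarrow> u \<noteq> v \<Longrightarrow> adj G u v"
    and same: "neighbours G a = neighbours G b"
  shows "digraph_iso G (S3_graph n)"
proof -
  define W where "W = neighbours G a"
  define C where "C = rest - W"
  have nb: "neighbours G a = W" "neighbours G b = W" using same by (auto simp: W_def)
  have adj_ab: "adj G a w \<longleftrightarrow> w \<in> W" "adj G b w \<longleftrightarrow> w \<in> W"
    "adj G w a \<longleftrightarrow> w \<in> W" "adj G w b \<longleftrightarrow> w \<in> W" for w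
    using nb adj_sym by (auto simp: neighbours_def)
  have ab_W: "a \<notin> W" "b \<notin> W" using adj_ab not_adj no_loops' by blast+
  have W: "W \<subseteq> rest" "finite W" "card W = 3"
    using neighbours_subset[of a] ab_W deg_ab
    by (auto simp: W_def rest_def out_degree_neighbours finite_neighbours)
  have "card rest = n - 2" using card_rest n by linarith
  then have C: "finite C" "card C = n - 5" using W by (auto simp: C_def card_Diff_subset)
  obtain f :: "'a \<Rightarrow> nat" where f: "bij_betw f W {0..<3}" using ex_bij_betw_finite_nat[OF W(2)] W(3) by auto
  obtain g :: "'a \<Rightarrow> nat" where g: "bij_betw g C {0..<n - 5}" using ex_bij_betw_finite_nat[OF C(1)] C(2) by auto
  have inj: "inj_on f W" "inj_on g C" using f g by (auto simp: bij_betw_def)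
  have f_less: "f w < 3" if "w \<in> W" for w using f that by (auto simp: bij_betw_def)
  have g_less: "g w < n - 5" if "w \<in> C" for w using g that by (auto simp: bij_betw_def)
  define h :: "'a \<Rightarrow> nat + (nat + nat \<times> nat)" where
    "h w = (if w \<in> W then Inl (f w) else if w = a then Inr (Inr (0, 0))
      else if w = b then Inr (Inr (1, 0)) else Inr (Inl (g w)))" for w
  have V: "pverts G = W \<union> C \<union> {a, b}" using ab W(1) by (auto simp: C_def rest_def)
  have C_ab: "w \<notin> W" "w \<noteq> a" "w \<noteq> b" if "w \<in> C" for w using that by (auto simp: C_def rest_def)
  have h: "\<And>w. w \<in> W \<Longrightarrow> h w = Inl (f w)" "\<And>w. w \<in> C \<Longrightarrow> h w = Inr (Inl (g w))"
    "h a = Inr (Inr (0, 0))" "h b = Inr (Inr (1, 0))"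
    using ab_W ab(3) C_ab by (auto simp: h_def)
  have inj_h: "inj_on h (pverts G)"
    unfolding V by (rule inj_onI) (auto simp: h inj_on_eq_iff[OF inj(1)] inj_on_eq_iff[OF inj(2)])
  have "h ` pverts G = pverts (S3_graph n)"
  proof (rule card_subset_eq)
    show "finite (pverts (S3_graph n))" by (simp add: verts_S3_graph)
    show "h ` pverts G \<subseteq> pverts (S3_graph n)" unfolding V verts_S3_graph using f_less g_less by (auto simp: h)
    show "card (h ` pverts G) = card (pverts (S3_graph n))"
      using n by (simp add: card_image[OF inj_h] card_verts verts_S3_graph card_Plus)
  qed
  then have bij: "bij_betw h (pverts G) (pverts (S3_graph n))" using inj_h by (simp add: bij_betw_def)
  have adj_rest: "adj G u v \<longleftrightarrow> u \<noteq> v" if "u \<in> rest" "v \<in> rest" for u v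
    using complete[OF that] no_loops' by blast
  have WC_rest: "w \<in> rest" if "w \<in> W \<or> w \<in> C" for w using that W(1) by (auto simp: C_def)
  have adj_h: "adj (S3_graph n) (h u) (h v) \<longleftrightarrow> adj G u v" if "u \<in> pverts G" "v \<in> pverts G" for u v
  proof -
    have f_eq: "f u = f v \<longleftrightarrow> u = v" if "u \<in> W" "v \<in> W" for u v
      using inj_on_eq_iff[OF inj(1)] that .
    have g_eq: "g u = g v \<longleftrightarrow> u = v" if "u \<in> C" "v \<in> C" for u v
      using inj_on_eq_iff[OF inj(2)] that .
    have classes: "w \<in> W \<or> w \<in> C \<or> w = a \<or> w = b" if "w \<in> pverts G" for w
      using that V by blast
    have disj: "u \<noteq> v" if "u \<in> W" "v \<in> C" for u v using that C_ab by blast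
    show ?thesis
      using classes[OF that(1)] classes[OF that(2)]
      by (elim disjE)
        (simp_all add: h adj_S3_graph f_less g_less f_eq g_eq adj_ab ab_W C_ab adj_rest WC_rest
          InlI InrI disj disj[symmetric])
  qed
  have "parcs (S3_graph n) \<subseteq> pverts (S3_graph n) \<times> pverts (S3_graph n)"
    by (auto simp: S3_graph_def graph_join_def disjoint_union_def complete_graph_def graph_copies_def)
  then show ?thesis using digraph_iso_of_bij[OF pair_graph _ bij adj_h] by blast
qed

end


section \<open>Hamilton-connectedness from the signless Laplacian radius\<close>

theorem theorem1p10:
  fixes G :: "'a pair_pre_digraph" and n :: nat
  assumes "pair_graph G"
    and "Digraph_Component.connected G"
    and "card (pverts G) = n"
    and "n \<ge> 13"
    and "min_degree G \<ge> 3"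
    and "signless_laplacian_radius G > 2 * real n - 6 + 6 / (real n - 1)"
  shows "hamilton_connected G \<or> digraph_iso G (S3_graph n)"
proof (rule disj_imp[THEN iffD2], rule impI)
  assume not_hc: "\<not> hamilton_connected G"
  note G = assms(1) and n = assms(3,4) and large = assms(6)
  interpret pair_graph G by fact
  let ?V = "pverts G" and ?d = "out_degree G"
  have deg: "?d v \<ge> 3" if "v \<in> ?V" for v
  proof -
    have "min_degree G \<le> ?d v" unfolding min_degree_def using that by (intro Min_le) auto
    then show ?thesis using assms(5) by linarith
  qed
  obtain k u where k2: "2 * k \<le> n" and u: "u \<in> ?V" "?d u \<le> k"
    and low: "k - 1 \<le> card {v \<in> ?V. ?d v \<le> k}"
    and mid: "n - k \<le> card {v \<in> ?V. ?d v \<le> n - k}"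
    by (rule degree_sequence_not_hamilton_connected[OF G not_hc, unfolded n(1)])
  have k: "2 * k \<le> n" "k \<ge> 3" using k2 u deg[of u] by linarith+
  have size: "(int n - 1) * (int n - 4) + 6 < int (card (parcs G))"
  proof -
    define N where "N = real n - 1"
    have N: "N > 0" using n by (simp add: N_def)
    have "?d v \<ge> 1" if "v \<in> ?V" for v using deg[OF that] by linarith
    then have "signless_laplacian_radius G \<le> real (card (parcs G)) / (real n - 1) + real n - 2"
      using radius_le_size[OF G] n by simp
    then have "2 * N - 4 + 6 / N < real (card (parcs G)) / N + N - 1"
      using large by (simp add: N_def)
    then have "(N * (N - 3) + 6) / N < real (card (parcs G)) / N"
      using N by (simp add: add_divide_distrib)
    then have "N * (N - 3) + 6 < real (card (parcs G))"
      using N by (simp add: divide_less_cancel)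
    then have "real_of_int ((int n - 1) * (int n - 4) + 6) < real_of_int (int (card (parcs G)))"
      by (simp add: N_def algebra_simps)
    then show ?thesis by (simp only: of_int_less_iff)
  qed
  have "int k = 3 \<or> int k = 6 \<and> int n = 13 \<or> int k = 7 \<and> int n = 14"
    using degree_sum_le[OF G n(1) _ k(1) low mid] size k n by (intro large_size_cases) auto
  then consider "k = 3" | "k = 6" "n = 13" | "k = 7" "n = 14" by linarith
  then show "digraph_iso G (S3_graph n)"
  proof cases
    case 1
    obtain T where T: "T \<subseteq> {v \<in> ?V. ?d v \<le> 3}" "card T = 2"
      using obtain_subset_with_card_n[OF low] 1 by auto
    then obtain a b where ab: "T = {a, b}" "a \<noteq> b" by (auto simp: card_2_iff)
    then have ab_V: "a \<in> ?V" "b \<in> ?V" and "?d a \<le> 3" "?d b \<le> 3" using T(1) by blast+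
    then have ab_deg: "?d a = 3" "?d b = 3" using deg[OF ab_V(1)] deg[OF ab_V(2)] by linarith+
    interpret two_cubic_vertices G a b n
      by unfold_locales (fact ab_V ab(2) ab_deg n)+
    have not_adj: "\<not> adj G a b"
    proof
      assume "adj G a b"
      from adjacent_radius_le[OF this] large show False by linarith
    qed
    moreover have complete: "adj G u v" if "u \<in> rest" "v \<in> rest" "u \<noteq> v" for u v
    proof (rule ccontr)
      assume "\<not> adj G u v"
      from missing_edge_radius_le[OF not_adj that this] large show False by linarith
    qed
    moreover have "neighbours G a = neighbours G b"
      using same_neighbours[OF not_adj complete] mid 1 by simp
    ultimately show ?thesis by (rule iso_S3)
  next
    case 2
    obtain L where L: "L \<subseteq> {v \<in> ?V. ?d v \<le> 7}" "card L = 7" "finite L"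
      using obtain_subset_with_card_n[OF mid] 2 by auto
    \<comment> \<open>The weight \<open>1 / 2\<close> makes the rows of the vertices outside \<open>L\<close> tight.\<close>
    have "card (?V - L) = 6" using L n 2 by (subst card_Diff_subset) auto
    then have "signless_laplacian_radius G \<le> 41 / 2"
      by (intro many_low_degrees_radius_le[OF G, of L 7 6 "1 / 2"]) (use L n 2 in auto)
    then show ?thesis using large 2 by simp
  next
    case 3
    obtain L where L: "L \<subseteq> {v \<in> ?V. ?d v \<le> 7}" "card L = 7" "finite L"
      using obtain_subset_with_card_n[OF mid] 3 by auto
    \<comment> \<open>Any weight in the interval from \<open>0.453\<close> to \<open>0.494\<close> would do.\<close>
    have "card (?V - L) = 7" using L n 3 by (subst card_Diff_subset) auto
    then have "signless_laplacian_radius G \<le> 22 + 6 / 13"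
      by (intro many_low_degrees_radius_le[OF G, of L 7 7 "12 / 25"]) (use L n 3 in auto)
    then show ?thesis using large 3 by simp
  qed
qed

end
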